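(* Let $n$ be an odd positive integer, let $H = \{x\in\mathbb{R}^n : 2\sum_{i=1}^n x_i = n\}$, and let $C = H\cap[0,1]^n$. Consider the pure integer problem $\max\{\sum_{i=1}^n x_i : x\in C\cap\mathbb{Z}^n\}$. This problem is infeasible (i.e., $C\cap\mathbb{Z}^n=\emptyset$), and, for every integer $s$ with $1\le s\le\lfloor n/2\rfloor$, any branch-and-bound proof of infeasibility based on split disjunctions of sparsity at most $s$ has size at least $\Omega\left(2^{\frac{n}{2s}}\right)$ (i.e., size at least $\kappa\, 2^{n/(2s)}$ for an absolute constant $\kappa>0$).
   Context: A split disjunction in $\mathbb{R}^n$ (with respect to $\mathbb{Z}^n$) is a union $\{x : \langle\pi,x\rangle\le\pi_0\}\cup\{x:\langle\pi,x\rangle\ge\pi_0+1\}$ with $\pi\in\mathbb{Z}^n$, $\pi_0\in\mathbb{Z}$. It has sparsity at most $s$ if the inequalities describing its two halfspaces have at most $s$ non-zero coefficients, i.e., $\pi$ has at most $s$ non-zero entries. A branch-and-bound proof (based on a family of disjunctions $Q_1\cup\dots\cup Q_k\supseteq\mathbb{Z}^n$) is a finite rooted tree whose nodes are convex subsets of $C$: the root is $C$, and each non-leaf node $N$ has as children the sets $Q_1\cap N,\dots,Q_k\cap N$ for some disjunction $Q_1\cup\dots\cup Q_k$ in the family. It is a proof of infeasibility if every leaf is the empty set. It is not required that the disjunction applied at a node cut off an optimal solution of the relaxation at that node. The size of the proof is the total number of nodes of the tree. *)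

theory Defs
  imports "Jordan_Normal_Form.Matrix" Complex_Main
begin

text \<open>
  The dimension \<open>n\<close> has to be quantified inside the theorem, below the absolute constant of the
  lower bound. Points of \<open>n\<close>-space are therefore elements of \<^term>\<open>carrier_vec n :: real vec set\<close>
  rather than of a type-indexed vector space.
\<close>

definition integer_points :: "nat \<Rightarrow> real vec set" where
  "integer_points n = {x \<in> carrier_vec n. \<forall>i<n. x $ i \<in> \<int>}"

text \<open>
  A disjunction \<open>Q\<^sub>1 \<union> \<dots> \<union> Q\<^sub>k\<close> is represented by the list \<open>[Q\<^sub>1, \<dots>, Q\<^sub>k]\<close> of its terms.
\<close>

definition is_disjunction :: "nat \<Rightarrow> real vec set list \<Rightarrow> bool" where
  "is_disjunction n Qs \<longleftrightarrow> integer_points n \<subseteq> \<Union> (set Qs)"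

definition split_disjunction :: "nat \<Rightarrow> int vec \<Rightarrow> int \<Rightarrow> real vec set list" where
  "split_disjunction n \<pi> \<pi>\<^sub>0 =
     [{x \<in> carrier_vec n. map_vec real_of_int \<pi> \<bullet> x \<le> real_of_int \<pi>\<^sub>0},
      {x \<in> carrier_vec n. map_vec real_of_int \<pi> \<bullet> x \<ge> real_of_int \<pi>\<^sub>0 + 1}]"

definition sparse_split_disjunctions :: "nat \<Rightarrow> nat \<Rightarrow> real vec set list set" where
  "sparse_split_disjunctions n s =
     {split_disjunction n \<pi> \<pi>\<^sub>0 | \<pi> \<pi>\<^sub>0. \<pi> \<in> carrier_vec n \<and> card {i. i < n \<and> \<pi> $ i \<noteq> 0} \<le> s}"

lemma sparse_split_is_disjunction:
  assumes "Qs \<in> sparse_split_disjunctions n s"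
  shows "is_disjunction n Qs"
proof -
  obtain \<pi> \<pi>\<^sub>0 where Qs: "Qs = split_disjunction n \<pi> \<pi>\<^sub>0" and \<pi>: "\<pi> \<in> carrier_vec n"
    using assms by (auto simp: sparse_split_disjunctions_def)
  have "map_vec real_of_int \<pi> \<bullet> x \<le> real_of_int \<pi>\<^sub>0 \<or> map_vec real_of_int \<pi> \<bullet> x \<ge> real_of_int \<pi>\<^sub>0 + 1"
    if x: "x \<in> integer_points n" for x
  proof -
    have "map_vec real_of_int \<pi> \<bullet> x \<in> \<int>"
      unfolding scalar_prod_def using x \<pi>
      by (intro Ints_sum Ints_mult) (auto simp: integer_points_def)
    then obtain k where k: "map_vec real_of_int \<pi> \<bullet> x = real_of_int k"
      by (auto elim: Ints_cases)
    have "k \<le> \<pi>\<^sub>0 \<or> k \<ge> \<pi>\<^sub>0 + 1"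
      by linarith
    then have "real_of_int k \<le> real_of_int \<pi>\<^sub>0 \<or> real_of_int k \<ge> real_of_int \<pi>\<^sub>0 + 1"
      by (metis of_int_1 of_int_add of_int_le_iff)
    then show ?thesis unfolding k .
  qed
  then show ?thesis
    by (auto simp: is_disjunction_def Qs split_disjunction_def integer_points_def)
qed

text \<open>
  Trees whose nodes are labelled by sets. Children form a list, so two children that happen to
  be equal as sets (such as two empty ones) are still distinct nodes and are counted separately.
\<close>

datatype 'a bb_tree = Node (region: "'a set") (children: "'a bb_tree list")

text \<open>The generated \<^const>\<open>size\<close> function also counts list cells, hence a separate node count.\<close>

primrec num_nodes :: "'a bb_tree \<Rightarrow> nat" where
  "num_nodes (Node N ts) = 1 + sum_list (map num_nodes ts)"

primrec branches_by :: "'a set list set \<Rightarrow> 'a bb_tree \<Rightarrow> bool" where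
  "branches_by F (Node N ts) \<longleftrightarrow>
     (ts = [] \<or> (\<exists>Qs\<in>F. map region ts = map (\<lambda>Q. Q \<inter> N) Qs)) \<and> list_all (branches_by F) ts"

primrec leaf_regions :: "'a bb_tree \<Rightarrow> 'a set set" where
  "leaf_regions (Node N ts) = (if ts = [] then {N} else \<Union> (set (map leaf_regions ts)))"

text \<open>
  For split disjunctions and a convex root \<open>C\<close>, every node is convex and contained in \<open>C\<close>, being an
  intersection of \<open>C\<close> with halfspaces; so this is not imposed separately.
\<close>

definition branch_and_bound_proof :: "'a set list set \<Rightarrow> 'a set \<Rightarrow> 'a bb_tree \<Rightarrow> bool" where
  "branch_and_bound_proof F C T \<longleftrightarrow> region T = C \<and> branches_by F T"

definition proof_of_infeasibility :: "'a set list set \<Rightarrow> 'a set \<Rightarrow> 'a bb_tree \<Rightarrow> bool" where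
  "proof_of_infeasibility F C T \<longleftrightarrow>
     branch_and_bound_proof F C T \<and> (\<forall>L\<in>leaf_regions T. L = {})"

definition half_sum_hyperplane :: "nat \<Rightarrow> real vec set" where
  "half_sum_hyperplane n = {x \<in> carrier_vec n. 2 * (\<Sum>i<n. x $ i) = real n}"

definition unit_cube :: "nat \<Rightarrow> real vec set" where
  "unit_cube n = {x \<in> carrier_vec n. \<forall>i<n. 0 \<le> x $ i \<and> x $ i \<le> 1}"

end

theory Submission
  imports Defs
begin

text \<open>
  Consider faces of the cube on which the coordinates in a set \<open>S\<close> are fixed to 0/1 values. Such a
  face meets the hyperplane whenever \<open>2 * card S \<le> n\<close>, so its intersection with \<open>C\<close> cannot lie in
  the region of an empty leaf. A split \<open>(\<pi>, \<pi>\<^sub>0)\<close> applied to a node containing the intersection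
  either has a term containing all of it, or else the maximal and the minimal vertex of the face
  with respect to \<open>\<pi>\<close> lie in different terms; then fixing in addition the at most \<open>s\<close> coordinates
  in the support of \<open>\<pi>\<close> as in these vertices yields a smaller face inside each of the two children.
  Hence the tree branches at least \<open>n / (2 * s)\<close> times along every sequence of such choices.
\<close>

text \<open>The pair \<open>S\<close>, \<open>A\<close> encodes a partial 0/1 assignment:
  \<open>A\<close> matters only inside \<open>S\<close>, so it can be any set of indices.\<close>

definition half_sum_face :: "nat \<Rightarrow> nat set \<Rightarrow> nat set \<Rightarrow> real vec set" where
  "half_sum_face n S A =
     {x \<in> half_sum_hyperplane n \<inter> unit_cube n. \<forall>i<n. i \<in> S \<longrightarrow> x $ i = of_bool (i \<in> A)}"

lemma half_sum_face_nonempty: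
  assumes "S \<subseteq> {..<n}" and "2 * card S \<le> n"
  shows "half_sum_face n S A \<noteq> {}"
proof -
  define a where "a = card (S \<inter> A)"
  \<comment> \<open>The common value of the free coordinates, solved from
    \<open>a + (n - card S) * c = n / 2\<close>. It lies in [0,1] because
    \<open>a \<le> card S\<close> and \<open>card S\<close> is at most half of
    \<open>n\<close>.\<close>
  define c where "c = (real n / 2 - real a) / (real n - real (card S))"
  define x where "x = vec n (\<lambda>i. if i \<in> S then of_bool (i \<in> A) else c)"
  have fin: "finite S"
    using assms(1) finite_subset by blast
  have a_le: "a \<le> card S"
    unfolding a_def by (simp add: card_mono fin)
  have c: "0 \<le> c" "c \<le> 1"
    using assms(2) a_le unfolding c_def by (auto simp: divide_simps)
  have "(\<Sum>i<n. x $ i) = (\<Sum>i<n. if i \<in> S then of_bool (i \<in> A) else c)"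
    by (simp add: x_def)
  also have "\<dots> = (\<Sum>i\<in>S. of_bool (i \<in> A)) + (\<Sum>i\<in>{..<n} - S. c)"
    using assms(1) by (simp add: sum.If_cases Int_absorb1 Diff_eq)
  also have "\<dots> = real a + (real n - real (card S)) * c"
    using assms fin
    by (simp add: a_def of_bool_def sum.If_cases Int_def card_Diff_subset of_nat_diff)
  \<comment> \<open>The denominator of \<open>c\<close> vanishes only for \<open>n = 0\<close>,
    where both sides are 0.\<close>
  also have "\<dots> = real n / 2"
    using assms(2) a_le by (cases "n = 0") (auto simp: c_def)
  finally have "2 * (\<Sum>i<n. x $ i) = real n"
    by simp
  then have "x \<in> half_sum_face n S A"
    using c by (auto simp: half_sum_face_def half_sum_hyperplane_def unit_cube_def x_def)
  then show ?thesis
    by blast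
qed

text \<open>The split normal evaluated at the 0/1 vertex with support \<open>A\<close>. Keeping it
  in \<open>int\<close> leaves no value strictly between \<open>\<pi>\<^sub>0\<close> and
  \<open>\<pi>\<^sub>0 + 1\<close>.\<close>

definition split_value :: "nat \<Rightarrow> int vec \<Rightarrow> nat set \<Rightarrow> int" where
  "split_value n \<pi> A = (\<Sum>i<n. \<pi> $ i * of_bool (i \<in> A))"

text \<open>The vertex of the cube face maximising \<open>\<pi>\<close>, with the hyperplane
  ignored: it need not belong to \<open>C\<close>. The next definition is the minimising
  counterpart.\<close>

definition extend_pos :: "int vec \<Rightarrow> nat set \<Rightarrow> nat set \<Rightarrow> nat set" where
  "extend_pos \<pi> S A = {i. if i \<in> S then i \<in> A else \<pi> $ i > 0}"

definition extend_neg :: "int vec \<Rightarrow> nat set \<Rightarrow> nat set \<Rightarrow> nat set" where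
  "extend_neg \<pi> S A = {i. if i \<in> S then i \<in> A else \<pi> $ i < 0}"

lemma scalar_prod_of_int_vec:
  assumes "\<pi> \<in> carrier_vec n" and "x \<in> carrier_vec n"
  shows "map_vec real_of_int \<pi> \<bullet> x = (\<Sum>i<n. of_int (\<pi> $ i) * x $ i)"
  using assms by (auto simp: scalar_prod_def atLeast0LessThan intro!: sum.cong)

text \<open>Coordinatewise, a fixed entry agrees with the vertex, and a free one in [0,1]
  contributes at most the positive part of its coefficient.\<close>

lemma half_sum_face_scalar_prod_le:
  assumes "\<pi> \<in> carrier_vec n" and "x \<in> half_sum_face n S A"
  shows "map_vec real_of_int \<pi> \<bullet> x \<le> of_int (split_value n \<pi> (extend_pos \<pi> S A))"
proof -
  have x: "x \<in> carrier_vec n" "\<And>i. i < n \<Longrightarrow> 0 \<le> x $ i \<and> x $ i \<le> 1"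
    "\<And>i. i < n \<Longrightarrow> i \<in> S \<Longrightarrow> x $ i = of_bool (i \<in> A)"
    using assms(2) by (auto simp: half_sum_face_def unit_cube_def)
  have "of_int (\<pi> $ i) * x $ i \<le> of_int (\<pi> $ i * of_bool (i \<in> extend_pos \<pi> S A))"
    if "i < n" for i
    using x(2)[OF that] x(3)[OF that]
    by (auto simp: extend_pos_def of_bool_def mult_le_cancel_left1 mult_nonpos_nonneg)
  then show ?thesis
    unfolding scalar_prod_of_int_vec[OF assms(1) x(1)] split_value_def of_int_sum
    by (intro sum_mono) auto
qed

lemma half_sum_face_scalar_prod_ge:
  assumes "\<pi> \<in> carrier_vec n" and "x \<in> half_sum_face n S A"
  shows "map_vec real_of_int \<pi> \<bullet> x \<ge> of_int (split_value n \<pi> (extend_neg \<pi> S A))"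
proof -
  have x: "x \<in> carrier_vec n" "\<And>i. i < n \<Longrightarrow> 0 \<le> x $ i \<and> x $ i \<le> 1"
    "\<And>i. i < n \<Longrightarrow> i \<in> S \<Longrightarrow> x $ i = of_bool (i \<in> A)"
    using assms(2) by (auto simp: half_sum_face_def unit_cube_def)
  have "of_int (\<pi> $ i) * x $ i \<ge> of_int (\<pi> $ i * of_bool (i \<in> extend_neg \<pi> S A))"
    if "i < n" for i
    using x(2)[OF that] x(3)[OF that]
    by (auto simp: extend_neg_def of_bool_def mult_le_cancel_left2)
  then show ?thesis
    unfolding scalar_prod_of_int_vec[OF assms(1) x(1)] split_value_def of_int_sum
    by (intro sum_mono) auto
qed

text \<open>With the whole support of \<open>\<pi>\<close> fixed, \<open>\<pi>\<close> is constant
  on the face. Thus the points of \<open>C\<close> in the face inherit the value of a vertex that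
  may lie outside \<open>C\<close>.\<close>

lemma half_sum_face_scalar_prod_eq:
  assumes "\<pi> \<in> carrier_vec n" and "x \<in> half_sum_face n S A"
    and "{i. i < n \<and> \<pi> $ i \<noteq> 0} \<subseteq> S"
  shows "map_vec real_of_int \<pi> \<bullet> x = of_int (split_value n \<pi> A)"
proof -
  have x: "x \<in> carrier_vec n"
    using assms(2) by (auto simp: half_sum_face_def unit_cube_def)
  show ?thesis
    unfolding scalar_prod_of_int_vec[OF assms(1) x] split_value_def of_int_sum
    using assms(2,3) by (intro sum.cong) (auto simp: half_sum_face_def)
qed

lemma half_sum_face_extend:
  assumes "\<And>i. i \<in> S \<Longrightarrow> i \<in> A' \<longleftrightarrow> i \<in> A"
  shows "half_sum_face n (S \<union> P) A' \<subseteq> half_sum_face n S A"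
  using assms by (auto simp: half_sum_face_def)

lemma num_nodes_pos: "num_nodes T \<ge> 1"
  by (cases T) simp

text \<open>The number \<open>k\<close> is a budget: how many more times \<open>s\<close>
  coordinates can be fixed with the face still meeting the hyperplane. The face and the budget vary
  in the induction, since children may receive smaller faces.\<close>

lemma num_nodes_ge_of_half_sum_face:
  assumes "branches_by (sparse_split_disjunctions n s) T"
    and "\<forall>L\<in>leaf_regions T. L = {}"
    and "half_sum_face n S A \<subseteq> region T"
    and "S \<subseteq> {..<n}"
    and "2 * (card S + k * s) \<le> n"
  shows "num_nodes T \<ge> 2 ^ (k + 1)"
  using assms
proof (induction T arbitrary: S A k)
  case (Node N ts)
  have fin: "finite S"
    using Node.prems(4) finite_subset by blast
  have "half_sum_face n S A \<noteq> {}"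
    using Node.prems(4,5) by (intro half_sum_face_nonempty) auto
  then have "ts \<noteq> []"
    using Node.prems(2,3) by auto
  then obtain Qs where Qs: "Qs \<in> sparse_split_disjunctions n s"
      "map region ts = map (\<lambda>Q. Q \<inter> N) Qs"
    using Node.prems(1) by auto
  then obtain \<pi> \<pi>\<^sub>0 where split: "Qs = split_disjunction n \<pi> \<pi>\<^sub>0" and \<pi>: "\<pi> \<in> carrier_vec n"
      and sparse: "card {i. i < n \<and> \<pi> $ i \<noteq> 0} \<le> s"
    by (auto simp: sparse_split_disjunctions_def)
  define P where "P = {i. i < n \<and> \<pi> $ i \<noteq> 0}"
  obtain t u where ts: "ts = [t, u]"
    and t: "region t = {x \<in> carrier_vec n. map_vec real_of_int \<pi> \<bullet> x \<le> real_of_int \<pi>\<^sub>0} \<inter> N"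
    and u: "region u = {x \<in> carrier_vec n. map_vec real_of_int \<pi> \<bullet> x \<ge> real_of_int \<pi>\<^sub>0 + 1} \<inter> N"
    using Qs(2) unfolding split split_disjunction_def by (auto simp: map_eq_Cons_conv)
  have sub: "branches_by (sparse_split_disjunctions n s) t" "\<forall>L\<in>leaf_regions t. L = {}"
    "branches_by (sparse_split_disjunctions n s) u" "\<forall>L\<in>leaf_regions u. L = {}"
    using Node.prems(1,2) by (auto simp: ts)
  have nodes: "num_nodes (Node N ts) = 1 + num_nodes t + num_nodes u"
    by (simp add: ts)
  have IHt: "2 ^ (j + 1) \<le> num_nodes t"
    if "half_sum_face n S' A' \<subseteq> region t" "S' \<subseteq> {..<n}" "2 * (card S' + j * s) \<le> n" for S' A' j
    using Node.IH[of t] sub that by (simp add: ts)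
  have IHu: "2 ^ (j + 1) \<le> num_nodes u"
    if "half_sum_face n S' A' \<subseteq> region u" "S' \<subseteq> {..<n}" "2 * (card S' + j * s) \<le> n" for S' A' j
    using Node.IH[of u] sub that by (simp add: ts)
  have face_carrier: "x \<in> carrier_vec n" if "x \<in> half_sum_face n S' A'" for x S' A'
    using that by (auto simp: half_sum_face_def unit_cube_def)
  have face_N: "half_sum_face n S A \<subseteq> N"
    using Node.prems(3) by simp
  \<comment> \<open>Exhaustive by integrality: a maximum above \<open>\<pi>\<^sub>0\<close> is at
    least \<open>\<pi>\<^sub>0 + 1\<close>, and a minimum below \<open>\<pi>\<^sub>0 + 1\<close> is
    at most \<open>\<pi>\<^sub>0\<close>.\<close>
  consider (pos) "split_value n \<pi> (extend_pos \<pi> S A) \<le> \<pi>\<^sub>0"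
    | (neg) "split_value n \<pi> (extend_neg \<pi> S A) \<ge> \<pi>\<^sub>0 + 1"
    | (both) "split_value n \<pi> (extend_pos \<pi> S A) \<ge> \<pi>\<^sub>0 + 1"
        "split_value n \<pi> (extend_neg \<pi> S A) \<le> \<pi>\<^sub>0"
    by linarith
  then show ?case
  proof cases
    case pos
    have "x \<in> region t" if x: "x \<in> half_sum_face n S A" for x
    proof -
      have "map_vec real_of_int \<pi> \<bullet> x \<le> real_of_int \<pi>\<^sub>0"
        using half_sum_face_scalar_prod_le[OF \<pi> x] pos by linarith
      then show ?thesis
        using face_carrier[OF x] face_N x by (auto simp: t)
    qed
    \<comment> \<open>The face passes to this child unchanged, so no budget is spent and one child
      already gives the full bound.\<close>
    then have "2 ^ (k + 1) \<le> num_nodes t"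
      using Node.prems(4,5) by (intro IHt) auto
    then show ?thesis
      using nodes by linarith
  next
    case neg
    have "x \<in> region u" if x: "x \<in> half_sum_face n S A" for x
    proof -
      have "map_vec real_of_int \<pi> \<bullet> x \<ge> real_of_int \<pi>\<^sub>0 + 1"
        using half_sum_face_scalar_prod_ge[OF \<pi> x] neg by linarith
      then show ?thesis
        using face_carrier[OF x] face_N x by (auto simp: u)
    qed
    then have "2 ^ (k + 1) \<le> num_nodes u"
      using Node.prems(4,5) by (intro IHu) auto
    then show ?thesis
      using nodes by linarith
  next
    case both
    show ?thesis
    proof (cases k)
      \<comment> \<open>The budget is exhausted, but the node is not a leaf: with its two children
        it gives 3 nodes, and 2 suffice.\<close>
      case 0
      then show ?thesis
        using nodes num_nodes_pos[of t] num_nodes_pos[of u] by simp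
    next
      case (Suc j)
      \<comment> \<open>Fixing the support costs at most \<open>s\<close> new coordinates, that is,
        one unit of the budget.\<close>
      have "card (S \<union> P) \<le> card S + s"
        using card_Un_le[of S P] sparse by (simp add: P_def)
      then have card: "2 * (card (S \<union> P) + j * s) \<le> n"
        using Node.prems(5) Suc by simp
      have SP: "S \<union> P \<subseteq> {..<n}" and supp: "{i. i < n \<and> \<pi> $ i \<noteq> 0} \<subseteq> S \<union> P"
        using Node.prems(4) by (auto simp: P_def)
      \<comment> \<open>The minimising vertex serves the lower child and the maximising one the
        upper child. Each then has at least \<open>2 ^ (j + 1)\<close> nodes, and the sum doubles
        this.\<close>
      have "x \<in> region t" if x: "x \<in> half_sum_face n (S \<union> P) (extend_neg \<pi> S A)" for x
      proof -
        have "map_vec real_of_int \<pi> \<bullet> x \<le> real_of_int \<pi>\<^sub>0"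
          using half_sum_face_scalar_prod_eq[OF \<pi> x supp] both(2) by linarith
        moreover have "x \<in> half_sum_face n S A"
          using half_sum_face_extend[of S "extend_neg \<pi> S A" A n P] x
          by (auto simp: extend_neg_def)
        ultimately show ?thesis
          using face_carrier[OF x] face_N by (auto simp: t)
      qed
      then have "2 ^ (j + 1) \<le> num_nodes t"
        using SP card by (intro IHt) auto
      moreover have "x \<in> region u" if x: "x \<in> half_sum_face n (S \<union> P) (extend_pos \<pi> S A)" for x
      proof -
        have "map_vec real_of_int \<pi> \<bullet> x \<ge> real_of_int \<pi>\<^sub>0 + 1"
          using half_sum_face_scalar_prod_eq[OF \<pi> x supp] both(1) by linarith
        moreover have "x \<in> half_sum_face n S A"
          using half_sum_face_extend[of S "extend_pos \<pi> S A" A n P] x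
          by (auto simp: extend_pos_def)
        ultimately show ?thesis
          using face_carrier[OF x] face_N by (auto simp: u)
      qed
      then have "2 ^ (j + 1) \<le> num_nodes u"
        using SP card by (intro IHu) auto
      ultimately show ?thesis
        using nodes Suc by simp
    qed
  qed
qed

text \<open>Parity: twice an integer sum cannot equal an odd \<open>n\<close>.\<close>

lemma half_sum_hyperplane_integer_points:
  assumes "odd n"
  shows "half_sum_hyperplane n \<inter> integer_points n = {}"
proof -
  have False if x: "x \<in> half_sum_hyperplane n" "x \<in> integer_points n" for x
  proof -
    have "(\<Sum>i<n. x $ i) \<in> \<int>"
      using x(2) by (intro Ints_sum) (auto simp: integer_points_def)
    then obtain z where "(\<Sum>i<n. x $ i) = of_int z"
      by (auto elim: Ints_cases)
    then have "real_of_int (2 * z) = real_of_int (int n)"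
      using x(1) by (simp add: half_sum_hyperplane_def)
    then have "2 * z = int n"
      by (simp only: of_int_eq_iff)
    then show False
      using assms by presburger
  qed
  then show ?thesis
    by blast
qed

lemma num_nodes_ge_sparse_split:
  assumes "s \<ge> 1"
    and "proof_of_infeasibility (sparse_split_disjunctions n s)
      (half_sum_hyperplane n \<inter> unit_cube n) T"
  shows "real (num_nodes T) \<ge> 2 powr (real n / (2 * real s))"
proof -
  \<comment> \<open>The largest budget available at the root, where \<open>S\<close> is empty and
    the face is all of \<open>C\<close>.\<close>
  define k where "k = n div (2 * s)"
  have "2 * (card ({} :: nat set) + k * s) \<le> n"
    using div_times_less_eq_dividend[of n "2 * s"] by (simp add: k_def algebra_simps)
  then have le: "2 ^ (k + 1) \<le> num_nodes T"
    using assms(2)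
    by (intro num_nodes_ge_of_half_sum_face[of n s T "{}" "{}"])
      (auto simp: proof_of_infeasibility_def branch_and_bound_proof_def half_sum_face_def)
  \<comment> \<open>Rounding down in \<open>k\<close> loses less than 1, which the extra 1 in the
    exponent \<open>k + 1\<close> absorbs.\<close>
  have "n < (k + 1) * (2 * s)"
    using assms(1) dividend_less_div_times[of "2 * s" n] by (simp add: k_def)
  then have "real n < real ((k + 1) * (2 * s))"
    by (simp only: of_nat_less_iff)
  then have "real n / (2 * real s) \<le> real (k + 1)"
    using assms(1) by (simp add: divide_simps algebra_simps)
  then have "2 powr (real n / (2 * real s)) \<le> 2 powr real (k + 1)"
    by (intro powr_mono) auto
  also have "\<dots> = real (2 ^ (k + 1))"
    by (simp only: powr_realpow zero_less_numeral of_nat_power of_nat_numeral)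
  also have "\<dots> \<le> real (num_nodes T)"
    using le by (simp only: of_nat_le_iff)
  finally show ?thesis .
qed

theorem corollary1p5:
  shows "\<exists>\<kappa>::real. \<kappa> > 0 \<and>
    (\<forall>n::nat. odd n \<longrightarrow>
      (let C = half_sum_hyperplane n \<inter> unit_cube n in
        C \<inter> integer_points n = {} \<and>
        (\<forall>s::nat. 1 \<le> s \<and> s \<le> n div 2 \<longrightarrow>
          (\<forall>T. proof_of_infeasibility (sparse_split_disjunctions n s) C T \<longrightarrow>
            real (num_nodes T) \<ge> \<kappa> * 2 powr (real n / (2 * real s))))))"
  \<comment> \<open>The bound just proved has no loss, so the absolute constant can be 1.\<close>
  using half_sum_hyperplane_integer_points num_nodes_ge_sparse_split
  by (intro exI[of _ 1]) (auto simp: Let_def)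

end
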